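(* Let $F:\mathbb{R}^n\times\mathbb{R}^d\to\mathbb{R}^n$, $\mathcal{X}\subseteq\mathbb{R}^n$ and $\Theta\subseteq\mathbb{R}^d$, with norms $\|\cdot\|_{\mathcal{X}}$ and $\|\cdot\|_{\Theta}$ on the respective spaces, and assume: (A1) there exists $c>0$ such that for all $\theta\in\Theta$ the map $x\mapsto F(x,\theta)$ is strongly infinitesimally contracting with respect to $\|\cdot\|_{\mathcal{X}}$ with rate $c$, i.e. $\operatorname{osL}_x(F)\le -c$; (A2) there exists $\ell_\theta\ge 0$ such that for all $x\in\mathcal{X}$ the map $\theta\mapsto F(x,\theta)$ is Lipschitz from $(\Theta,\|\cdot\|_{\Theta})$ to $(\mathcal{X},\|\cdot\|_{\mathcal{X}})$ with constant $\ell_\theta$, i.e. $\|F(x,\theta_1)-F(x,\theta_2)\|_{\mathcal{X}}\le \ell_\theta\|\theta_1-\theta_2\|_{\Theta}$ for all $\theta_1,\theta_2\in\Theta$. Let $\theta:[0,\infty)\to\Theta$ be continuously differentiable, let $x(\cdot)$ be any solution (for any initial conditions $x(0)$, $\theta(0)$) of $$\dot x(t)=F(x(t),\theta(t)),\qquad t\ge 0,$$ and let $t\mapsto x^\star(\theta(t))$ be the time-varying equilibrium curve. Then for all $t\ge 0$: (i) $\displaystyle \|x(t)-x^\star(\theta(t))\|_{\mathcal{X}}\le e^{-ct}\|x(0)-x^\star(\theta(0))\|_{\mathcal{X}}+\frac{\ell_\theta}{c}\int_0^t e^{-c(t-\tau)}\|\dot\theta(\tau)\|_{\Theta}\,d\tau$;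 (ii) $\displaystyle \|F(x(t),\theta(t))\|_{\mathcal{X}}\le e^{-ct}\|F(x(0),\theta(0))\|_{\mathcal{X}}+\ell_\theta\int_0^t e^{-c(t-\tau)}\|\dot\theta(\tau)\|_{\Theta}\,d\tau$; (iii) the following asymptotic bounds hold: $$\limsup_{t\to\infty}\|x(t)-x^\star(\theta(t))\|_{\mathcal{X}}\le\frac{\ell_\theta}{c^2}\limsup_{t\to\infty}\|\dot\theta(t)\|_{\Theta},\qquad \limsup_{t\to\infty}\|F(x(t),\theta(t))\|_{\mathcal{X}}\le\frac{\ell_\theta}{c}\limsup_{t\to\infty}\|\dot\theta(t)\|_{\Theta}.$$
   Context: $\|\cdot\|_{\mathcal{X}}$ is a norm on $\mathbb{R}^n$ (used on $\mathcal{X}$) and $\|\cdot\|_{\Theta}$ is a norm on $\mathbb{R}^d$ (used on $\Theta$). For all $t\ge0$ the state $x(t)$ takes values in $\mathcal{X}$ and $\theta(t)$ takes values in $\Theta$. For each fixed parameter, the vector field is continuous in $x$ (and $F$ is continuous). One-sided Lipschitz constant: for a continuous $G:\mathbb{R}^n\to\mathbb{R}^n$ and a norm $\|\cdot\|$, $\operatorname{osL}(G)\le b$ means that for all $x\ne y$, $\lim_{h\to0^+}\frac{\|x-y+h(G(x)-G(y))\|-\|x-y\|}{h}\le b\|x-y\|$. (For $\|x\|_P=\sqrt{x^\top P x}$ this is $(G(x)-G(y))^\top P(x-y)\le b\|x-y\|_P^2$; for locally Lipschitz $G$ it is equivalent to $\mu(DG(x))\le b$ for almost every $x$, where $\mu(A)=\lim_{h\to0^+}(\|I_n+hA\|-1)/h$.)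 $\operatorname{osL}_x(F)\le -c$ means $\operatorname{osL}(F(\cdot,\theta))\le -c$ for every $\theta\in\Theta$. Under (A1), for each $\theta\in\Theta$ there is a unique $x^\star_\theta\in\mathcal{X}$ with $F(x^\star_\theta,\theta)=0$; the map $x^\star:\Theta\to\mathcal{X}$ is $x^\star(\theta)=x^\star_\theta$. The time-varying equilibrium curve is $t\mapsto x^\star(\theta(t))$. *)

theory Defs
  imports "HOL-Analysis.Analysis"
begin

text \<open>An arbitrary norm on a real vector space, in general different from the
  Euclidean \<^const>\<open>norm\<close> of the type.\<close>

definition is_norm :: "('a::real_vector \<Rightarrow> real) \<Rightarrow> bool" where
  "is_norm N \<longleftrightarrow>
     (\<forall>x. 0 \<le> N x) \<and>
     (\<forall>x. N x = 0 \<longleftrightarrow> x = 0) \<and>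
     (\<forall>a x. N (a *\<^sub>R x) = \<bar>a\<bar> * N x) \<and>
     (\<forall>x y. N (x + y) \<le> N x + N y)"

text \<open>\<open>osL_le N G b\<close> stands for \<open>osL(G) \<le> b\<close> with respect to the norm \<open>N\<close>.
  For a norm the difference quotient is nondecreasing in \<open>h\<close> and bounded below, so the
  limit always exists and the existential quantifier only names it.\<close>

definition osL_le ::
  "(real^'n \<Rightarrow> real) \<Rightarrow> (real^'n \<Rightarrow> real^'n) \<Rightarrow> real \<Rightarrow> bool" where
  "osL_le N G b \<longleftrightarrow>
     (\<forall>x y. x \<noteq> y \<longrightarrow>
        (\<exists>l. ((\<lambda>h. (N (x - y + h *\<^sub>R (G x - G y)) - N (x - y)) / h) \<longlongrightarrow> l) (at_right 0) \<and>
             l \<le> b * N (x - y)))"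

text \<open>If \<open>F(\<cdot>, \<theta>)\<close> is continuous and \<open>osL(F(\<cdot>, \<theta>)) \<le> -c\<close> with \<open>c > 0\<close>, it has exactly one
  zero in the whole space, so the description below is proper.\<close>

definition equilibrium ::
  "((real^'n) \<times> (real^'d) \<Rightarrow> real^'n) \<Rightarrow> real^'d \<Rightarrow> real^'n" where
  "equilibrium F \<theta> = (THE x. F (x, \<theta>) = 0)"

end

theory Submission imports Defs begin

text \<open>Everything rests on one differential inequality, read with one-sided derivatives because
  neither \<open>NX\<close> nor the equilibrium curve need be differentiable: if
  \<open>D\<^sup>+ u \<le> - c u + g\<close>, then
  \<open>u t \<le> e\<^bsup>-ct\<^esup> u 0 + \<integral> e\<^bsup>-c(t-\<tau>)\<^esup> g \<tau> d\<tau>\<close> (lemma \<open>right_dini_gronwall\<close>).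

  The condition \<open>osL \<le> - c\<close> enters twice. Along a curve whose velocity is a difference
  \<open>G p - G q\<close>, up to a disturbance \<open>r\<close>, it makes the norm of \<open>p - q\<close> decay at rate \<open>c\<close>,
  up to \<open>N r\<close> (\<open>osL_le_dini_norm\<close>). It also makes \<open>G\<close> expansive,
  \<open>c N (p - q) \<le> N (G p - G q)\<close>. Hence \<open>G\<close> is injective with closed range; the range is open
  by invariance of domain, so \<open>G\<close> has exactly one zero (\<open>osL_le_unique_zero\<close>). The
  same expansiveness shows that the zero is a Lipschitz function of the parameter with constant
  \<open>\<l> / c\<close>.

  For the distance to the equilibrium, freeze the equilibrium at time \<open>t\<close>. The distance to the
  frozen point decays at rate \<open>c\<close>, and the motion of the equilibrium adds at most
  \<open>\<l> / c\<close> times the speed of the parameter.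

  The bound on \<open>F (x t, \<theta> t)\<close> cannot be obtained by differentiating that function, as \<open>F\<close> is
  merely continuous. It is the velocity of \<open>x\<close>, however, so it is enough to bound the increments
  \<open>x (t + h) - x t\<close> for a fixed \<open>h\<close> and let \<open>h\<close> tend to \<open>0\<close> at the end. Their velocity is
  \<open>F (x (t + h), \<theta> (t + h)) - F (x t, \<theta> t)\<close>, a difference of values of the
  contracting field with parameter \<open>\<theta> (t + h)\<close>, plus a disturbance
  \<open>F (x t, \<theta> (t + h)) - F (x t, \<theta> t)\<close> that the Lipschitz condition bounds by \<open>\<l>\<close> times the
  increment of \<open>\<theta>\<close>.

  Both asymptotic bounds follow by splitting the convolution at a time after which the parameter
  speed is almost below its limit superior (\<open>limsup_exponential_convolution\<close>).\<close>

section \<open>Scalar differential inequalities\<close>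

text \<open>If \<open>w\<close> ended above the line of slope \<open>\<epsilon>\<close> through its initial value, then at the last time
  at which it is on or below that line the Dini condition would keep it there a little longer.\<close>

lemma right_dini_nonpos_imp_le:
  fixes w :: "real \<Rightarrow> real"
  assumes ab: "a \<le> b" and cont: "continuous_on {a..b} w"
    and dini: "\<And>t \<epsilon>. a \<le> t \<Longrightarrow> t < b \<Longrightarrow> 0 < \<epsilon> \<Longrightarrow>
                 \<forall>\<^sub>F h in at_right 0. w (t + h) \<le> w t + h * \<epsilon>"
  shows "w b \<le> w a"
proof -
  have main: "w b \<le> w a + \<epsilon> * (b - a)" if \<epsilon>: "\<epsilon> > 0" for \<epsilon>
  proof -
    define S where "S = {t \<in> {a..b}. w t - \<epsilon> * (t - a) \<le> w a}"
    have "S = {a..b} \<inter> (\<lambda>t. w t - \<epsilon> * (t - a)) -` {..w a}"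
      by (auto simp: S_def)
    moreover have "closed ({a..b} \<inter> (\<lambda>t. w t - \<epsilon> * (t - a)) -` {..w a})"
      by (intro continuous_closed_preimage continuous_intros cont closed_atMost)
    moreover have "S \<subseteq> {a..b}" by (auto simp: S_def)
    ultimately have "compact S"
      using bounded_subset[OF bounded_closed_interval] by (metis compact_eq_bounded_closed)
    moreover have "a \<in> S" using ab by (simp add: S_def)
    ultimately obtain s where s: "s \<in> S" "\<And>t. t \<in> S \<Longrightarrow> t \<le> s"
      using compact_attains_sup[of S] by blast
    have "s = b"
    proof (rule ccontr)
      assume "s \<noteq> b"
      then have "a \<le> s" "s < b" using s(1) by (auto simp: S_def)
      then have "\<forall>\<^sub>F h in at_right 0. 0 < h \<and> h < b - s"
        by (auto simp: eventually_at_right_field intro!: exI[of _ "b - s"])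
      with dini[OF \<open>a \<le> s\<close> \<open>s < b\<close> \<epsilon>]
      have "\<forall>\<^sub>F h in at_right 0. w (s + h) \<le> w s + h * \<epsilon> \<and> 0 < h \<and> h < b - s"
        by (rule eventually_conj)
      then obtain h where h: "w (s + h) \<le> w s + h * \<epsilon>" "0 < h" "h < b - s"
        using eventually_happens by force
      then have "s + h \<in> S" using s(1) \<open>a \<le> s\<close> by (auto simp: S_def algebra_simps)
      then show False using s(2) h by force
    qed
    then show ?thesis using s(1) by (simp add: S_def)
  qed
  show ?thesis
  proof (cases "a = b")
    case False
    then have "b - a > 0" using ab by simp
    show ?thesis
    proof (rule field_le_epsilon)
      fix e :: real assume "e > 0"
      then show "w b \<le> w a + e"
        using main[of "e / (b - a)"] \<open>b - a > 0\<close> by simp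
    qed
  qed simp
qed

lemma exp_decay_split: "exp (- c * (t - \<tau>)) = exp (- c * t) * exp (c * \<tau>)" for c t \<tau> :: real
  unfolding exp_add[symmetric] by (simp add: algebra_simps)

text \<open>With the integrating factor \<open>e\<^bsup>ct\<^esup>\<close> the claim says that
  \<open>e\<^bsup>ct\<^esup> u t - \<integral> e\<^bsup>c\<tau>\<^esup> g \<tau> d\<tau>\<close> ends no higher than it starts. Stating the Dini derivative as
  an inequality between increments keeps all suprema out of the proofs.\<close>

lemma right_dini_gronwall:
  fixes u g :: "real \<Rightarrow> real"
  assumes T: "0 \<le> T" and u: "continuous_on {0..T} u" and g: "continuous_on {0..T} g"
    and dini: "\<And>t \<epsilon>. 0 \<le> t \<Longrightarrow> t < T \<Longrightarrow> 0 < \<epsilon> \<Longrightarrow>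
                 \<forall>\<^sub>F h in at_right 0. u (t + h) \<le> u t + h * (- c * u t + g t + \<epsilon>)"
  shows "u T \<le> exp (- c * T) * u 0 + integral {0..T} (\<lambda>\<tau>. exp (- c * (T - \<tau>)) * g \<tau>)"
proof -
  define I where "I t = integral {0..t} (\<lambda>\<tau>. exp (c * \<tau>) * g \<tau>)" for t
  have eg: "continuous_on {0..T} (\<lambda>\<tau>. exp (c * \<tau>) * g \<tau>)"
    by (intro continuous_intros g)
  have I_deriv: "(I has_vector_derivative exp (c * t) * g t) (at t within {0..T})"
    if "t \<in> {0..T}" for t
    unfolding I_def using integral_has_vector_derivative[OF eg that] .
  then have I_cont: "continuous_on {0..T} I"
    by (meson continuous_on_eq_continuous_within has_vector_derivative_continuous)
  define w where "w t = exp (c * t) * u t - I t" for t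
  have "w T \<le> w 0"
  proof (rule right_dini_nonpos_imp_le[OF T])
    show "continuous_on {0..T} w"
      unfolding w_def by (intro continuous_intros u I_cont)
  next
    fix t \<epsilon> :: real assume t: "0 \<le> t" "t < T" and \<epsilon>: "0 < \<epsilon>"
    define \<delta> where "\<delta> = \<epsilon> / (2 * exp (c * t))"
    have \<delta>: "\<delta> > 0" "exp (c * t) * \<delta> = \<epsilon> / 2" using \<epsilon> by (auto simp: \<delta>_def)
    \<comment> \<open>\<open>R\<close> is \<open>w\<close> with \<open>u\<close> replaced by its linear upper bound from the Dini condition.
      Like \<open>w\<close> it has the value \<open>w t\<close> at \<open>t\<close>, and it has the right derivative \<open>\<epsilon> / 2\<close> there.\<close>
    define R where "R s = exp (c * s) * (u t + (s - t) * (- c * u t + g t + \<delta>)) - I s" for s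
    have "(I has_real_derivative exp (c * t) * g t) (at t within {0..T})"
      using I_deriv[of t] t by (simp add: has_real_derivative_iff_has_vector_derivative)
    then have "(I has_real_derivative exp (c * t) * g t) (at_right t)"
      using t at_within_Icc_at_right[of t T]
      by (metis DERIV_subset atLeastatMost_subset_iff order_refl)
    then have "(R has_real_derivative
          (exp (c * t) * c * u t + exp (c * t) * (- c * u t + g t + \<delta>) - exp (c * t) * g t)) (at_right t)"
      unfolding R_def by (auto intro!: derivative_eq_intros)
    also have "exp (c * t) * c * u t + exp (c * t) * (- c * u t + g t + \<delta>) - exp (c * t) * g t = \<epsilon> / 2"
      using \<delta>(2) by (simp add: algebra_simps)
    finally have "((\<lambda>s. (R s - R t) / (s - t)) \<longlongrightarrow> \<epsilon> / 2) (at_right t)"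
      by (simp add: has_field_derivative_iff)
    then have "\<forall>\<^sub>F s in at_right t. (R s - R t) / (s - t) < \<epsilon>"
      by (rule order_tendstoD(2)) (use \<epsilon> in simp)
    then have "\<forall>\<^sub>F h in at_right 0. (R (t + h) - R t) / h < \<epsilon>"
      by (simp add: at_right_to_0[of t] eventually_filtermap add.commute)
    moreover have "\<forall>\<^sub>F h in at_right 0. u (t + h) \<le> u t + h * (- c * u t + g t + \<delta>)"
      using dini t \<delta> by blast
    moreover have "\<forall>\<^sub>F h in at_right (0::real). 0 < h"
      by (simp add: eventually_at_right_less)
    ultimately show "\<forall>\<^sub>F h in at_right 0. w (t + h) \<le> w t + h * \<epsilon>"
    proof eventually_elim
      case (elim h)
      have "w (t + h) \<le> R (t + h)"
        using elim(2) by (simp add: w_def R_def)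
      also have "\<dots> \<le> R t + h * \<epsilon>"
        using elim(1,3) by (simp add: field_simps)
      also have "R t = w t" by (simp add: w_def R_def)
      finally show ?case .
    qed
  qed
  then have "exp (c * T) * u T \<le> u 0 + I T"
    by (simp add: w_def I_def)
  then have "exp (- c * T) * (exp (c * T) * u T) \<le> exp (- c * T) * (u 0 + I T)"
    by (rule mult_left_mono) simp
  moreover have "exp (- c * T) * (exp (c * T) * u T) = u T"
    by (simp add: exp_minus)
  moreover have "exp (- c * T) * I T = integral {0..T} (\<lambda>\<tau>. exp (- c * (T - \<tau>)) * g \<tau>)"
    unfolding I_def integral_mult_right[symmetric]
    by (rule integral_cong) (simp only: exp_decay_split mult.assoc)
  ultimately show ?thesis by (simp only: distrib_left)
qed

text \<open>The part of the convolution before a time \<open>T\<close> is forgotten exponentially, and the part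
  after \<open>T\<close> is at most \<open>M / c\<close> if \<open>g \<le> M\<close> there. As the right-hand side is a product in the
  extended reals, \<open>0 \<cdot> \<infinity> = 0\<close> can occur in it: for \<open>k = 0\<close> the bound has to come from the
  decay of the initial term alone.\<close>

lemma limsup_exponential_convolution:
  fixes u g :: "real \<Rightarrow> real"
  assumes c: "c > 0" and k: "k \<ge> 0" and g: "continuous_on {0..} g" and g_nonneg: "\<And>t. 0 \<le> g t"
    and bound: "\<And>t. t \<ge> 0 \<Longrightarrow>
      u t \<le> exp (- c * t) * A + k * integral {0..t} (\<lambda>\<tau>. exp (- c * (t - \<tau>)) * g \<tau>)"
  shows "Limsup at_top (\<lambda>t. ereal (u t)) \<le> ereal (k / c) * Limsup at_top (\<lambda>t. ereal (g t))"
proof -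
  have settle: "Limsup at_top (\<lambda>t. ereal (u t)) \<le> ereal K"
    if "\<forall>\<^sub>F t in at_top. u t \<le> exp (- c * t) * B + K" for B K
  proof -
    have "((\<lambda>t. exp (- c * t)) \<longlongrightarrow> 0) at_top"
      using c by (intro filterlim_compose[OF exp_at_bot]
          filterlim_tendsto_neg_mult_at_bot[OF tendsto_const _ filterlim_ident]) simp
    then have "((\<lambda>t. exp (- c * t) * B + K) \<longlongrightarrow> 0 * B + K) at_top"
      by (intro tendsto_intros)
    then have "Limsup at_top (\<lambda>t. ereal (exp (- c * t) * B + K)) = ereal K"
      by (intro lim_imp_Limsup) auto
    moreover have "Limsup at_top (\<lambda>t. ereal (u t)) \<le> Limsup at_top (\<lambda>t. ereal (exp (- c * t) * B + K))"
      by (rule Limsup_mono) (use that in simp)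
    ultimately show ?thesis by simp
  qed
  have eventual: "Limsup at_top (\<lambda>t. ereal (u t)) \<le> ereal (k / c * M)"
    if M: "M \<ge> 0" "\<forall>\<^sub>F t in at_top. g t \<le> M" for M
  proof -
    obtain T where T: "T \<ge> 0" "\<And>t. t \<ge> T \<Longrightarrow> g t \<le> M"
      using M(2) unfolding eventually_at_top_linorder by (metis linorder_linear order_trans)
    define J where "J = integral {0..T} (\<lambda>\<tau>. exp (c * \<tau>) * g \<tau>)"
    have "u t \<le> exp (- c * t) * (A + k * J) + k / c * M" if t: "t \<ge> T" for t
    proof -
      have int: "(\<lambda>\<tau>. exp (- c * (t - \<tau>)) * g \<tau>) integrable_on {a..b}" if "0 \<le> a" for a b
        by (intro integrable_continuous_interval continuous_intros continuous_on_subset[OF g])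
          (use that in auto)
      have "integral {0..T} (\<lambda>\<tau>. exp (- c * (t - \<tau>)) * g \<tau>) = exp (- c * t) * J"
        unfolding J_def integral_mult_right[symmetric]
        by (rule integral_cong) (simp only: exp_decay_split mult.assoc)
      moreover have "integral {T..t} (\<lambda>\<tau>. exp (- c * (t - \<tau>)) * g \<tau>) \<le> M / c"
      proof -
        have "((\<lambda>\<tau>. exp (- c * (t - \<tau>)) * M) has_integral
            (exp (- c * (t - t)) * (M / c) - exp (- c * (t - T)) * (M / c))) {T..t}"
        proof (rule fundamental_theorem_of_calculus[OF t])
          fix \<tau>
          have "((\<lambda>\<tau>. exp (- c * (t - \<tau>)) * (M / c)) has_real_derivative
              exp (- c * (t - \<tau>)) * M) (at \<tau> within {T..t})"
            using c by (auto intro!: derivative_eq_intros)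
          then show "((\<lambda>\<tau>. exp (- c * (t - \<tau>)) * (M / c)) has_vector_derivative
              exp (- c * (t - \<tau>)) * M) (at \<tau> within {T..t})"
            by (simp add: has_real_derivative_iff_has_vector_derivative)
        qed
        then have "integral {T..t} (\<lambda>\<tau>. exp (- c * (t - \<tau>)) * g \<tau>)
            \<le> exp (- c * (t - t)) * (M / c) - exp (- c * (t - T)) * (M / c)"
          using int[OF T(1), of t] T(2)
          by (intro has_integral_le[OF integrable_integral]) auto
        also have "\<dots> \<le> M / c" using c M(1) by simp
        finally show ?thesis .
      qed
      ultimately have "integral {0..t} (\<lambda>\<tau>. exp (- c * (t - \<tau>)) * g \<tau>) \<le> exp (- c * t) * J + M / c"
        using Henstock_Kurzweil_Integration.integral_combine[OF T(1) t int[of 0 t]] by simp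
      from mult_left_mono[OF this k] bound[of t] t T(1) show ?thesis
        by (simp add: algebra_simps)
    qed
    then show ?thesis
      by (intro settle) (auto simp: eventually_at_top_linorder)
  qed
  let ?L = "Limsup at_top (\<lambda>t. ereal (g t))"
  have "ereal 0 \<le> ?L"
    by (rule le_Limsup) (auto simp: g_nonneg)
  consider "k = 0" | "k > 0" "?L = \<infinity>" | L where "?L = ereal L" "L \<ge> 0"
    using k \<open>ereal 0 \<le> ?L\<close> by (cases ?L) (auto simp: less_le)
  then show ?thesis
  proof cases
    case 1
    then have "\<forall>\<^sub>F t in at_top. u t \<le> exp (- c * t) * A + 0"
      using bound unfolding eventually_at_top_linorder by (intro exI[of _ 0]) auto
    from settle[OF this] 1 show ?thesis by (simp add: zero_ereal_def[symmetric])
  next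
    case 2
    then show ?thesis using c by simp
  next
    case 3
    show ?thesis
    proof (rule ereal_le_epsilon2)
      fix e :: real assume e: "0 < e"
      define d where "d = e / (k / c + 1)"
      have kc: "k / c \<ge> 0" using k c by simp
      have d: "d > 0" using e kc by (simp add: d_def)
      have "k / c + 1 \<noteq> 0" using kc by linarith
      then have "(k / c + 1) * d = e" unfolding d_def by simp
      then have "k / c * d \<le> e" using d by (simp only: distrib_right)
      have "\<forall>\<^sub>F t in at_top. ereal (g t) < ereal (L + d)"
        by (rule Limsup_lessD) (use 3 d in simp)
      then have "\<forall>\<^sub>F t in at_top. g t \<le> L + d"
        by (rule eventually_mono) simp
      then have "Limsup at_top (\<lambda>t. ereal (u t)) \<le> ereal (k / c * (L + d))"
        using eventual[of "L + d"] 3 d by simp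
      also have "\<dots> \<le> ereal (k / c) * ?L + ereal e"
        using 3 \<open>k / c * d \<le> e\<close> by (simp add: distrib_left)
      finally show "Limsup at_top (\<lambda>t. ereal (u t)) \<le> ereal (k / c) * ?L + ereal e" .
    qed
  qed
qed

section \<open>Norms on Euclidean space\<close>

lemma
  assumes "is_norm N"
  shows is_norm_nonneg: "0 \<le> N x" and is_norm_eq_0: "N x = 0 \<longleftrightarrow> x = 0"
    and is_norm_scale: "N (a *\<^sub>R x) = \<bar>a\<bar> * N x"
    and is_norm_triangle: "N (x + y) \<le> N x + N y"
  using assms by (auto simp: is_norm_def)

lemma is_norm_minus_commute:
  assumes "is_norm N" shows "N (x - y) = N (y - x)"
  using is_norm_scale[OF assms, of "-1" "x - y"] by simp

lemma is_norm_triangle_sub: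
  assumes "is_norm N" shows "N x \<le> N y + N (x - y)"
  using is_norm_triangle[OF assms, of y "x - y"] by simp

lemma is_norm_continuous:
  fixes N :: "'a::euclidean_space \<Rightarrow> real"
  assumes "is_norm N" shows "continuous_on S N"
proof -
  have "convex_on UNIV N"
  proof (rule convex_onI)
    fix t :: real and x y :: 'a assume t: "0 < t" "t < 1"
    show "N ((1 - t) *\<^sub>R x + t *\<^sub>R y) \<le> (1 - t) * N x + t * N y"
      using is_norm_triangle[OF assms, of "(1 - t) *\<^sub>R x" "t *\<^sub>R y"] t
      by (simp add: is_norm_scale[OF assms])
  qed simp
  then have "continuous_on UNIV N" by (intro convex_on_continuous) auto
  then show ?thesis using continuous_on_subset by blast
qed

text \<open>Derivatives and completeness of the type refer to the Euclidean norm, whereas all estimates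
  are in terms of \<open>N\<close>; these constants pass from one to the other.\<close>

lemma is_norm_equivalent:
  fixes N :: "'a::euclidean_space \<Rightarrow> real"
  assumes N: "is_norm N"
  obtains m M where "0 < m" "0 < M" "\<And>x. m * norm x \<le> N x" "\<And>x. N x \<le> M * norm x"
proof -
  let ?S = "sphere (0::'a) 1"
  have S: "compact ?S" "?S \<noteq> {}" by auto
  obtain p where p: "p \<in> ?S" "\<And>x. x \<in> ?S \<Longrightarrow> N p \<le> N x"
    using continuous_attains_inf[OF S is_norm_continuous[OF N]] by blast
  obtain q where q: "q \<in> ?S" "\<And>x. x \<in> ?S \<Longrightarrow> N x \<le> N q"
    using continuous_attains_sup[OF S is_norm_continuous[OF N]] by blast
  have pos: "0 < N z" if "z \<in> ?S" for z
    using that is_norm_nonneg[OF N, of z] is_norm_eq_0[OF N, of z] by (auto simp: less_le)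
  have *: "N p * norm x \<le> N x \<and> N x \<le> N q * norm x" for x
  proof (cases "x = 0")
    case True
    then show ?thesis using is_norm_eq_0[OF N, of 0] by simp
  next
    case False
    define y where "y = x /\<^sub>R norm x"
    have "y \<in> ?S" "N x = norm x * N y"
      using False by (auto simp: y_def is_norm_scale[OF N])
    then show ?thesis using p(2)[of y] q(2)[of y]
      by (metis mult.commute mult_right_mono norm_ge_zero)
  qed
  show ?thesis by (rule that[OF pos[OF p(1)] pos[OF q(1)]]) (use * in auto)
qed

text \<open>The derivative of a curve, restated in the norm \<open>N\<close> and in terms of increments, the form in
  which it is fed into \<open>right_dini_gronwall\<close>.\<close>

lemma right_derivative_approx:
  fixes y :: "real \<Rightarrow> 'a::euclidean_space"
  assumes N: "is_norm N" and y: "(y has_vector_derivative v) (at t within {0..})"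
    and t: "0 \<le> t" and \<epsilon>: "0 < \<epsilon>"
  shows "\<forall>\<^sub>F h in at_right 0. N (y (t + h) - y t - h *\<^sub>R v) \<le> h * \<epsilon>"
proof -
  obtain m M where M: "0 < M" "\<And>x. N x \<le> M * norm x"
    using is_norm_equivalent[OF N] by metis
  have "\<epsilon> / M > 0" using \<epsilon> M by simp
  with y obtain d where d: "d > 0"
    "\<And>s. s \<in> {0..} \<Longrightarrow> norm (s - t) < d \<Longrightarrow>
       norm (y s - y t - (s - t) *\<^sub>R v) \<le> \<epsilon> / M * norm (s - t)"
    unfolding has_vector_derivative_def has_derivative_within_alt by blast
  have "N (y (t + h) - y t - h *\<^sub>R v) \<le> h * \<epsilon>" if h: "0 < h" "h < d" for h
  proof -
    have "norm (y (t + h) - y t - h *\<^sub>R v) \<le> \<epsilon> / M * h"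
      using d(2)[of "t + h"] h t by simp
    then have "M * norm (y (t + h) - y t - h *\<^sub>R v) \<le> M * (\<epsilon> / M * h)"
      using M(1) by (intro mult_left_mono) auto
    then show ?thesis using M by (intro order_trans[OF M(2)]) (simp add: mult.commute)
  qed
  then show ?thesis using d(1) by (auto simp: eventually_at_right_field)
qed

text \<open>For a continuously differentiable curve the difference quotients converge uniformly on
  compact intervals. The bound has to hold for all \<open>\<tau>\<close> with the same \<open>h\<close>, because it is used
  under an integral over \<open>\<tau>\<close>.\<close>

lemma C1_right_difference_bound:
  fixes \<theta> \<theta>' :: "real \<Rightarrow> 'a::euclidean_space"
  assumes N: "is_norm N"
    and deriv: "\<And>t. t \<ge> 0 \<Longrightarrow> (\<theta> has_vector_derivative \<theta>' t) (at t within {0..})"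
    and cont: "continuous_on {0..} \<theta>'" and \<epsilon>: "0 < \<epsilon>"
  shows "\<forall>\<^sub>F h in at_right 0. \<forall>\<tau>\<in>{0..T}. N (\<theta> (\<tau> + h) - \<theta> \<tau>) \<le> h * (N (\<theta>' \<tau>) + \<epsilon>)"
proof -
  obtain m M where M: "0 < M" "\<And>x. N x \<le> M * norm x"
    using is_norm_equivalent[OF N] by metis
  have "uniformly_continuous_on {0..T + 1} \<theta>'"
    by (intro compact_uniformly_continuous continuous_on_subset[OF cont]) auto
  moreover have "\<epsilon> / M > 0" using \<epsilon> M(1) by simp
  ultimately obtain d where d: "d > 0"
    "\<And>s \<tau>. s \<in> {0..T + 1} \<Longrightarrow> \<tau> \<in> {0..T + 1} \<Longrightarrow> dist s \<tau> < d \<Longrightarrow> dist (\<theta>' s) (\<theta>' \<tau>) < \<epsilon> / M"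
    unfolding uniformly_continuous_on_def by metis
  have "N (\<theta> (\<tau> + h) - \<theta> \<tau>) \<le> h * (N (\<theta>' \<tau>) + \<epsilon>)"
    if h: "0 < h" "h < min d 1" and \<tau>: "\<tau> \<in> {0..T}" for h \<tau>
  proof -
    have "norm (\<theta> (\<tau> + h) - \<theta> \<tau> - (\<tau> + h - \<tau>) *\<^sub>R \<theta>' \<tau>) \<le> norm (\<tau> + h - \<tau>) * (\<epsilon> / M)"
    proof (rule vector_differentiable_bound_linearization)
      show "(\<theta> has_vector_derivative \<theta>' s) (at s within {\<tau>..\<tau> + h})" if "s \<in> {\<tau>..\<tau> + h}" for s
        using that \<tau> by (intro has_vector_derivative_within_subset[OF deriv]) auto
      show "norm (\<theta>' s - \<theta>' \<tau>) \<le> \<epsilon> / M" if "s \<in> {\<tau>..\<tau> + h}" for s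
        using d(2)[of s \<tau>] that \<tau> h by (simp add: dist_norm)
    qed (use h in \<open>auto simp: closed_segment_eq_real_ivl\<close>)
    then have "M * norm (\<theta> (\<tau> + h) - \<theta> \<tau> - h *\<^sub>R \<theta>' \<tau>) \<le> M * (h * (\<epsilon> / M))"
      using h M(1) by (intro mult_left_mono) auto
    with M(2)[of "\<theta> (\<tau> + h) - \<theta> \<tau> - h *\<^sub>R \<theta>' \<tau>"] M(1)
    have "N (\<theta> (\<tau> + h) - \<theta> \<tau> - h *\<^sub>R \<theta>' \<tau>) \<le> h * \<epsilon>" by simp
    with is_norm_triangle_sub[OF N, of "\<theta> (\<tau> + h) - \<theta> \<tau>" "h *\<^sub>R \<theta>' \<tau>"] h show ?thesis
      by (simp add: is_norm_scale[OF N] distrib_left)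
  qed
  then show ?thesis
    using d(1) unfolding eventually_at_right_field by (intro exI[of _ "min d 1"]) auto
qed

section \<open>One-sided Lipschitz vector fields\<close>

text \<open>For \<open>x = y\<close> the one-sided Lipschitz condition is silent, but then both sides differ by
  \<open>h \<epsilon>\<close> only. A trajectory may pass through the
  equilibrium or return to an earlier state, so this case does occur.\<close>

lemma osL_le_eventually:
  assumes N: "is_norm N" and G: "osL_le N G b" and \<epsilon>: "0 < \<epsilon>"
  shows "\<forall>\<^sub>F h in at_right 0.
           N (x - y + h *\<^sub>R (G x - G y)) \<le> N (x - y) + h * (b * N (x - y) + \<epsilon>)"
proof (cases "x = y")
  case True
  then show ?thesis using \<epsilon> is_norm_eq_0[OF N, of 0]
    by (auto simp: eventually_at_right_field intro!: exI[of _ 1])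
next
  case False
  then obtain l where l: "l \<le> b * N (x - y)"
    "((\<lambda>h. (N (x - y + h *\<^sub>R (G x - G y)) - N (x - y)) / h) \<longlongrightarrow> l) (at_right 0)"
    using G unfolding osL_le_def by blast
  have "\<forall>\<^sub>F h in at_right 0.
      (N (x - y + h *\<^sub>R (G x - G y)) - N (x - y)) / h < b * N (x - y) + \<epsilon>"
    by (rule order_tendstoD(2)[OF l(2)]) (use l(1) \<epsilon> in simp)
  moreover have "\<forall>\<^sub>F h in at_right (0::real). 0 < h"
    by (simp add: eventually_at_right_less)
  ultimately show ?thesis
    by eventually_elim (simp add: field_simps)
qed

text \<open>The norm cannot fall faster than the speed \<open>N (G x - G y)\<close> permits, while the one-sided
  Lipschitz condition forces it to fall at rate at least \<open>c N (x - y)\<close>.\<close>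

lemma osL_le_expansive:
  assumes N: "is_norm N" and G: "osL_le N G (- c)"
  shows "c * N (x - y) \<le> N (G x - G y)"
proof (rule field_le_epsilon)
  fix e :: real assume e: "0 < e"
  have "\<forall>\<^sub>F h in at_right (0::real). 0 < h \<and>
      N (x - y + h *\<^sub>R (G x - G y)) \<le> N (x - y) + h * (- c * N (x - y) + e)"
    by (intro eventually_conj eventually_at_right_less osL_le_eventually[OF N G e])
  then obtain h where h: "0 < h"
    "N (x - y + h *\<^sub>R (G x - G y)) \<le> N (x - y) + h * (- c * N (x - y) + e)"
    using eventually_happens by force
  have "N (x - y) \<le> N (x - y + h *\<^sub>R (G x - G y)) + h * N (G x - G y)"
    using is_norm_triangle_sub[OF N, of "x - y" "x - y + h *\<^sub>R (G x - G y)"]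
      is_norm_scale[OF N, of "- h" "G x - G y"] h(1) by simp
  with h have "h * (c * N (x - y)) \<le> h * (N (G x - G y) + e)"
    by (simp add: algebra_simps)
  then show "c * N (x - y) \<le> N (G x - G y) + e" using h(1) by simp
qed

text \<open>By expansiveness \<open>G\<close> is injective and, by completeness, has closed range. A continuous
  injection of \<open>\<real>\<^sup>n\<close> into itself is open, so the range is both open and closed and \<open>G\<close> is onto.\<close>

lemma osL_le_unique_zero:
  fixes G :: "real^'n \<Rightarrow> real^'n"
  assumes N: "is_norm N" and c: "c > 0" and G: "osL_le N G (- c)" and cont: "continuous_on UNIV G"
  shows "\<exists>!z. G z = 0"
proof -
  have inj: "inj G"
  proof (rule injI)
    fix x y assume "G x = G y"
    then have "c * N (x - y) \<le> 0"
      using osL_le_expansive[OF N G, of x y] is_norm_eq_0[OF N, of 0] by simp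
    then have "N (x - y) = 0"
      using c is_norm_nonneg[OF N, of "x - y"] by (simp add: mult_le_0_iff)
    then show "x = y" using is_norm_eq_0[OF N] by simp
  qed
  obtain m M where mM: "0 < m" "0 < M" "\<And>x. m * norm x \<le> N x" "\<And>x. N x \<le> M * norm x"
    using is_norm_equivalent[OF N] by metis
  define k where "k = c * m / M"
  have k: "k > 0" using mM c by (simp add: k_def)
  have exp: "k * norm (x - y) \<le> norm (G x - G y)" for x y
  proof -
    have "c * (m * norm (x - y)) \<le> c * N (x - y)"
      using c mM(3) by (intro mult_left_mono) auto
    also have "\<dots> \<le> M * norm (G x - G y)"
      using osL_le_expansive[OF N G] mM(4) by (rule order_trans)
    finally show ?thesis using mM by (simp add: k_def field_simps)
  qed
  have "closed (range G)"
    unfolding closed_sequential_limits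
  proof (intro allI impI, elim conjE)
    fix w l assume w: "\<forall>n. w n \<in> range G" and l: "w \<longlonglongrightarrow> l"
    then obtain z where z: "w = (\<lambda>n. G (z n))"
      unfolding image_def by (auto simp: fun_eq_iff) metis
    have "Cauchy z"
    proof (rule metric_CauchyI)
      fix e :: real assume "0 < e"
      then have "0 < k * e" using k by simp
      then obtain n0 where n0: "\<And>i j. i \<ge> n0 \<Longrightarrow> j \<ge> n0 \<Longrightarrow> dist (w i) (w j) < k * e"
        using LIMSEQ_imp_Cauchy[OF l] metric_CauchyD by metis
      have "dist (z i) (z j) < e" if "i \<ge> n0" "j \<ge> n0" for i j
      proof -
        have "k * norm (z i - z j) < k * e"
          using exp[of "z i" "z j"] n0[OF that] z by (simp add: dist_norm)
        then show ?thesis using k by (simp add: dist_norm)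
      qed
      then show "\<exists>n0. \<forall>i\<ge>n0. \<forall>j\<ge>n0. dist (z i) (z j) < e" by blast
    qed
    then have "convergent z" by (rule Cauchy_convergent)
    then obtain a where a: "z \<longlonglongrightarrow> a" unfolding convergent_def ..
    have "isCont G a" using cont by (simp add: continuous_on_eq_continuous_at)
    then have "(\<lambda>n. G (z n)) \<longlonglongrightarrow> G a" using a by (rule isCont_tendsto_compose)
    with l have "l = G a" unfolding z by (rule LIMSEQ_unique)
    then show "l \<in> range G" by (rule range_eqI)
  qed
  moreover have "open (range G)"
    using invariance_of_domain[OF cont] inj by simp
  ultimately have "range G = UNIV"
    using clopen[of "range G"] by auto
  then obtain z where "G z = 0" by (metis surj_def)
  then show ?thesis using inj by (metis injD)
qed

text \<open>The factor \<open>b\<close> multiplies the distance of the points \<open>p\<close> and \<open>q\<close> where \<open>G\<close> is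
  evaluated; the hypothesis \<open>y t = p - q\<close> is imposed at the single time \<open>t\<close> only. This covers
  both a trajectory compared with a frozen point and a trajectory compared with its own time
  shift.\<close>

lemma osL_le_dini_norm:
  assumes N: "is_norm N" and G: "osL_le N G b" and t: "0 \<le> t"
    and y: "(y has_vector_derivative G p - G q + r) (at t within {0..})" and y_t: "y t = p - q"
    and \<epsilon>: "0 < \<epsilon>"
  shows "\<forall>\<^sub>F h in at_right 0. N (y (t + h)) \<le> N (y t) + h * (b * N (y t) + N r + \<epsilon>)"
proof -
  let ?v = "G p - G q"
  have "\<forall>\<^sub>F h in at_right 0. N (y (t + h) - y t - h *\<^sub>R (?v + r)) \<le> h * (\<epsilon> / 2)"
    by (rule right_derivative_approx[OF N y t]) (use \<epsilon> in simp)
  moreover have "\<forall>\<^sub>F h in at_right 0. N (y t + h *\<^sub>R ?v) \<le> N (y t) + h * (b * N (y t) + \<epsilon> / 2)"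
    unfolding y_t by (rule osL_le_eventually[OF N G]) (use \<epsilon> in simp)
  moreover have "\<forall>\<^sub>F h in at_right (0::real). 0 < h"
    by (simp add: eventually_at_right_less)
  ultimately show ?thesis
  proof eventually_elim
    case (elim h)
    have "N (y (t + h)) \<le> N (y t + h *\<^sub>R (?v + r)) + h * (\<epsilon> / 2)"
      using is_norm_triangle_sub[OF N, of "y (t + h)" "y t + h *\<^sub>R (?v + r)"] elim(1)
      by (simp add: diff_diff_add)
    moreover have "N (y t + h *\<^sub>R (?v + r)) \<le> N (y t + h *\<^sub>R ?v) + h * N r"
      using is_norm_triangle[OF N, of "y t + h *\<^sub>R ?v" "h *\<^sub>R r"] elim(3)
      by (simp add: is_norm_scale[OF N] scaleR_add_right add.assoc)
    moreover have "h * (b * N (y t) + N r + \<epsilon>)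
        = h * (b * N (y t) + \<epsilon> / 2) + h * N r + h * (\<epsilon> / 2)"
      by (simp add: algebra_simps)
    ultimately show ?case using elim(2) by linarith
  qed
qed

section \<open>Tracking a time-varying equilibrium\<close>

theorem theorem2:
  fixes F :: "(real^'n) \<times> (real^'d) \<Rightarrow> real^'n"
    and X :: "(real^'n) set" and \<Theta> :: "(real^'d) set"
    and NX :: "real^'n \<Rightarrow> real" and N\<Theta> :: "real^'d \<Rightarrow> real"
    and c \<l> :: real
    and \<theta> \<theta>' :: "real \<Rightarrow> real^'d" and x :: "real \<Rightarrow> real^'n"
  assumes normX: "is_norm NX" and norm\<Theta>: "is_norm N\<Theta>"
    and contF: "continuous_on (UNIV \<times> \<Theta>) F"
    and c_pos: "c > 0"
    and A1: "\<And>p. p \<in> \<Theta> \<Longrightarrow> osL_le NX (\<lambda>z. F (z, p)) (- c)"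
    and l_nonneg: "\<l> \<ge> 0"
    and A2: "\<And>z p q. z \<in> X \<Longrightarrow> p \<in> \<Theta> \<Longrightarrow> q \<in> \<Theta> \<Longrightarrow>
               NX (F (z, p) - F (z, q)) \<le> \<l> * N\<Theta> (p - q)"
    and equilibrium_in: "equilibrium F \<in> \<Theta> \<rightarrow> X"
    and \<theta>_in: "\<theta> \<in> {0..} \<rightarrow> \<Theta>"
    and \<theta>_deriv: "\<And>t. t \<ge> 0 \<Longrightarrow> (\<theta> has_vector_derivative \<theta>' t) (at t within {0..})"
    and \<theta>'_cont: "continuous_on {0..} \<theta>'"
    and x_in: "x \<in> {0..} \<rightarrow> X"
    and x_solution: "\<And>t. t \<ge> 0 \<Longrightarrow>
               (x has_vector_derivative F (x t, \<theta> t)) (at t within {0..})"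
  shows "(\<forall>t\<ge>0. NX (x t - equilibrium F (\<theta> t))
            \<le> exp (- c * t) * NX (x 0 - equilibrium F (\<theta> 0))
              + \<l> / c * integral {0..t} (\<lambda>\<tau>. exp (- c * (t - \<tau>)) * N\<Theta> (\<theta>' \<tau>))) \<and>
         (\<forall>t\<ge>0. NX (F (x t, \<theta> t))
            \<le> exp (- c * t) * NX (F (x 0, \<theta> 0))
              + \<l> * integral {0..t} (\<lambda>\<tau>. exp (- c * (t - \<tau>)) * N\<Theta> (\<theta>' \<tau>))) \<and>
         Limsup at_top (\<lambda>t. ereal (NX (x t - equilibrium F (\<theta> t))))
            \<le> ereal (\<l> / c\<^sup>2) * Limsup at_top (\<lambda>t. ereal (N\<Theta> (\<theta>' t))) \<and>
         Limsup at_top (\<lambda>t. ereal (NX (F (x t, \<theta> t))))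
            \<le> ereal (\<l> / c) * Limsup at_top (\<lambda>t. ereal (N\<Theta> (\<theta>' t)))"
proof -
  let ?g = "\<lambda>\<tau>. N\<Theta> (\<theta>' \<tau>)"
  let ?f = "\<lambda>t. F (x t, \<theta> t)"
  define xs where "xs t = equilibrium F (\<theta> t)" for t
  note NX_tri = is_norm_triangle[OF normX] and NX_sub = is_norm_triangle_sub[OF normX]
  have g_cont: "continuous_on {0..} ?g"
    by (rule continuous_on_compose2[OF is_norm_continuous[OF norm\<Theta>, of UNIV] \<theta>'_cont]) simp
  have x_cont: "continuous_on {0..} x"
    using x_solution by (meson atLeast_iff continuous_on_eq_continuous_within has_vector_derivative_continuous)
  have \<theta>_cont: "continuous_on {0..} \<theta>"
    using \<theta>_deriv by (meson atLeast_iff continuous_on_eq_continuous_within has_vector_derivative_continuous)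

  have F_xs: "F (xs t, \<theta> t) = 0" and xs_X: "xs t \<in> X" and osL: "osL_le NX (\<lambda>z. F (z, \<theta> t)) (- c)"
    if "t \<ge> 0" for t
  proof -
    have p: "\<theta> t \<in> \<Theta>" using \<theta>_in that by auto
    show "xs t \<in> X" using equilibrium_in p by (auto simp: xs_def)
    show *: "osL_le NX (\<lambda>z. F (z, \<theta> t)) (- c)" by (rule A1[OF p])
    have "continuous_on UNIV (\<lambda>z. F (z, \<theta> t))"
      by (rule continuous_on_compose2[OF contF]) (use p in \<open>auto intro!: continuous_intros\<close>)
    from theI'[OF osL_le_unique_zero[OF normX c_pos * this]]
    show "F (xs t, \<theta> t) = 0" by (simp add: xs_def equilibrium_def)
  qed

  have xs_lipschitz: "NX (xs s - xs t) \<le> \<l> / c * N\<Theta> (\<theta> s - \<theta> t)" if "s \<ge> 0" "t \<ge> 0" for s t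
  proof -
    have "c * NX (xs s - xs t) \<le> NX (F (xs s, \<theta> s) - F (xs t, \<theta> s))"
      by (rule osL_le_expansive[OF normX osL[OF that(1)]])
    also have "\<dots> = NX (F (xs t, \<theta> s) - F (xs t, \<theta> t))"
      using F_xs that is_norm_minus_commute[OF normX, of 0] by simp
    also have "\<dots> \<le> \<l> * N\<Theta> (\<theta> s - \<theta> t)"
      using A2[OF xs_X[OF that(2)]] \<theta>_in that by auto
    finally show ?thesis using c_pos by (simp add: field_simps)
  qed
  have xs_cont: "continuous_on {0..} xs"
  proof -
    obtain m M where m: "0 < m" "\<And>z. m * norm z \<le> NX z"
      using is_norm_equivalent[OF normX] by metis
    obtain k M where M: "0 < M" "\<And>z. N\<Theta> z \<le> M * norm z"
      using is_norm_equivalent[OF norm\<Theta>] by metis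
    define L where "L = \<l> / c * M / m"
    have L: "norm (xs s - xs t) \<le> L * norm (\<theta> s - \<theta> t)" if "s \<ge> 0" "t \<ge> 0" for s t
    proof -
      have "m * norm (xs s - xs t) \<le> \<l> / c * N\<Theta> (\<theta> s - \<theta> t)"
        using m(2) xs_lipschitz[OF that] by (rule order_trans)
      also have "\<dots> \<le> \<l> / c * (M * norm (\<theta> s - \<theta> t))"
        using M(2) l_nonneg c_pos by (intro mult_left_mono) auto
      finally show ?thesis using m(1) c_pos by (simp add: L_def field_simps)
    qed
    show ?thesis
      unfolding continuous_on_def
    proof
      fix t :: real assume t: "t \<in> {0..}"
      then have "(\<theta> \<longlongrightarrow> \<theta> t) (at t within {0..})"
        using \<theta>_cont by (simp add: continuous_on_def)
      then have "((\<lambda>s. L * norm (\<theta> s - \<theta> t)) \<longlongrightarrow> L * norm (\<theta> t - \<theta> t)) (at t within {0..})"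
        by (intro tendsto_intros)
      then have "((\<lambda>s. L * norm (\<theta> s - \<theta> t)) \<longlongrightarrow> 0) (at t within {0..})" by simp
      moreover have "\<forall>\<^sub>F s in at t within {0..}. norm (xs s - xs t) \<le> L * norm (\<theta> s - \<theta> t)"
        unfolding eventually_at_filter using L t by (intro always_eventually) simp
      ultimately have "((\<lambda>s. xs s - xs t) \<longlongrightarrow> 0) (at t within {0..})"
        by (rule Lim_null_comparison[rotated])
      then show "(xs \<longlongrightarrow> xs t) (at t within {0..})" by (rule LIM_zero_cancel)
    qed
  qed

  \<comment> \<open>First bound: the equilibrium is frozen at time \<open>t\<close>, and its own motion is charged separately
    through its Lipschitz constant.\<close>
  have bound_i: "NX (x T - xs T) \<le> exp (- c * T) * NX (x 0 - xs 0)
      + \<l> / c * integral {0..T} (\<lambda>\<tau>. exp (- c * (T - \<tau>)) * ?g \<tau>)" if T: "T \<ge> 0" for T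
  proof -
    have "NX (x T - xs T) \<le> exp (- c * T) * NX (x 0 - xs 0)
        + integral {0..T} (\<lambda>\<tau>. exp (- c * (T - \<tau>)) * (\<l> / c * ?g \<tau>))"
    proof (rule right_dini_gronwall[OF T])
      show "continuous_on {0..T} (\<lambda>t. NX (x t - xs t))"
        by (rule continuous_on_compose2[OF is_norm_continuous[OF normX, of UNIV]])
          (auto intro!: continuous_intros continuous_on_subset[OF x_cont] continuous_on_subset[OF xs_cont])
      show "continuous_on {0..T} (\<lambda>\<tau>. \<l> / c * ?g \<tau>)"
        by (intro continuous_intros continuous_on_subset[OF g_cont]) auto
    next
      fix t \<epsilon> :: real assume t: "0 \<le> t" "t < T" and \<epsilon>: "0 < \<epsilon>"
      define k where "k = \<l> / c"
      have k: "k \<ge> 0" using l_nonneg c_pos by (simp add: k_def)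
      \<comment> \<open>An error \<open>\<delta>\<close> from the trajectory and \<open>k \<delta>\<close> from the equilibrium add up to \<open>\<epsilon>\<close>.\<close>
      define \<delta> where "\<delta> = \<epsilon> / (1 + k)"
      have "1 + k \<noteq> 0" using k by linarith
      then have "(1 + k) * \<delta> = \<epsilon>" by (simp add: \<delta>_def)
      moreover have "\<delta> > 0" using \<epsilon> k by (simp add: \<delta>_def)
      ultimately have \<delta>: "\<delta> > 0" "\<epsilon> = \<delta> + k * \<delta>" by (simp_all add: distrib_right)
      have "((\<lambda>s. x s - xs t) has_vector_derivative F (x t, \<theta> t) - F (xs t, \<theta> t) + 0)
          (at t within {0..})"
        using x_solution[OF t(1)] F_xs[OF t(1)] by (auto intro!: derivative_eq_intros)
      from osL_le_dini_norm[OF normX osL[OF t(1)] t(1) this refl \<delta>(1)]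
      have "\<forall>\<^sub>F h in at_right 0. NX (x (t + h) - xs t)
          \<le> NX (x t - xs t) + h * (- c * NX (x t - xs t) + \<delta>)"
        using is_norm_eq_0[OF normX, of 0] by simp
      moreover have "\<forall>\<^sub>F h in at_right 0. N\<Theta> (\<theta> (t + h) - \<theta> t) \<le> h * (?g t + \<delta>)"
        using C1_right_difference_bound[OF norm\<Theta> \<theta>_deriv \<theta>'_cont \<delta>(1), of T]
        by (rule eventually_mono) (use t in auto)
      moreover have "\<forall>\<^sub>F h in at_right (0::real). 0 < h"
        by (simp add: eventually_at_right_less)
      ultimately show "\<forall>\<^sub>F h in at_right 0. NX (x (t + h) - xs (t + h))
          \<le> NX (x t - xs t) + h * (- c * NX (x t - xs t) + \<l> / c * ?g t + \<epsilon>)"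
      proof eventually_elim
        case (elim h)
        have "NX (x (t + h) - xs (t + h)) \<le> NX (x (t + h) - xs t) + NX (xs (t + h) - xs t)"
          using NX_tri[of "x (t + h) - xs t" "xs t - xs (t + h)"]
            is_norm_minus_commute[OF normX, of "xs t"] by simp
        moreover have "NX (xs (t + h) - xs t) \<le> k * (h * (?g t + \<delta>))"
          using xs_lipschitz[of "t + h" t] t(1) elim(3) mult_left_mono[OF elim(2) k]
          by (simp add: k_def)
        moreover have "h * (- c * NX (x t - xs t) + k * ?g t + \<epsilon>)
            = h * (- c * NX (x t - xs t) + \<delta>) + k * (h * (?g t + \<delta>))"
          by (subst \<delta>(2)) (simp add: algebra_simps)
        ultimately show ?case using elim(1) unfolding k_def by linarith
      qed
    qed
    also have "(\<lambda>\<tau>. exp (- c * (T - \<tau>)) * (\<l> / c * ?g \<tau>)) = (\<lambda>\<tau>. \<l> / c * (exp (- c * (T - \<tau>)) * ?g \<tau>))"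
      by (simp add: mult.left_commute)
    finally show ?thesis by (simp only: integral_mult_right)
  qed

  \<comment> \<open>Second bound: compare the trajectory with its shift by a fixed small \<open>h\<close>, then divide by \<open>h\<close>.\<close>
  have bound_ii: "NX (?f T) \<le> exp (- c * T) * NX (?f 0)
      + \<l> * integral {0..T} (\<lambda>\<tau>. exp (- c * (T - \<tau>)) * ?g \<tau>)" if T: "T \<ge> 0" for T
  proof (rule field_le_epsilon)
    fix e :: real assume e: "0 < e"
    let ?I = "integral {0..T} (\<lambda>\<tau>. exp (- c * (T - \<tau>)) * ?g \<tau>)"
    define E where "E = integral {0..T} (\<lambda>\<tau>. exp (- c * (T - \<tau>)))"
    have E: "E \<ge> 0" unfolding E_def
      by (intro integral_nonneg integrable_continuous_interval continuous_intros) auto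
    \<comment> \<open>\<open>K\<close> collects the coefficients of \<open>\<epsilon>\<close>: from the increment at \<open>T\<close>, from the
      increment at \<open>0\<close>, and from the bound on the increments of \<open>\<theta>\<close> under the integral.\<close>
    define K where "K = 1 + exp (- c * T) + \<l> * E"
    have K: "K > 0" using E l_nonneg by (auto simp: K_def intro!: add_pos_nonneg)
    define \<epsilon> where "\<epsilon> = e / K"
    have \<epsilon>: "\<epsilon> > 0" "e = \<epsilon> * K" using e K by (auto simp: \<epsilon>_def)
    have "\<forall>\<^sub>F h in at_right (0::real). 0 < h \<and>
        NX (x (T + h) - x T - h *\<^sub>R ?f T) \<le> h * \<epsilon> \<and>
        NX (x (0 + h) - x 0 - h *\<^sub>R ?f 0) \<le> h * \<epsilon> \<and>
        (\<forall>\<tau>\<in>{0..T}. N\<Theta> (\<theta> (\<tau> + h) - \<theta> \<tau>) \<le> h * (?g \<tau> + \<epsilon>))"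
      by (intro eventually_conj eventually_at_right_less
          C1_right_difference_bound[OF norm\<Theta> \<theta>_deriv \<theta>'_cont \<epsilon>(1)]
          right_derivative_approx[OF normX x_solution[OF T] T \<epsilon>(1)]
          right_derivative_approx[OF normX x_solution[OF order_refl] order_refl \<epsilon>(1)])
    then obtain h where h: "0 < h"
      and h_T: "NX (x (T + h) - x T - h *\<^sub>R ?f T) \<le> h * \<epsilon>"
      and h_0: "NX (x (0 + h) - x 0 - h *\<^sub>R ?f 0) \<le> h * \<epsilon>"
      and h_\<theta>: "\<And>\<tau>. \<tau> \<in> {0..T} \<Longrightarrow> N\<Theta> (\<theta> (\<tau> + h) - \<theta> \<tau>) \<le> h * (?g \<tau> + \<epsilon>)"
      using eventually_happens by force
    let ?y = "\<lambda>t. x (t + h) - x t"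
    have "NX (?y T) \<le> exp (- c * T) * NX (?y 0)
        + integral {0..T} (\<lambda>\<tau>. exp (- c * (T - \<tau>)) * (\<l> * (h * (?g \<tau> + \<epsilon>))))"
    proof (rule right_dini_gronwall[OF T])
      show "continuous_on {0..T} (\<lambda>t. NX (?y t))"
        by (rule continuous_on_compose2[OF is_norm_continuous[OF normX, of UNIV]])
          (use h in \<open>auto intro!: continuous_intros continuous_on_compose2[OF x_cont]\<close>)
      show "continuous_on {0..T} (\<lambda>\<tau>. \<l> * (h * (?g \<tau> + \<epsilon>)))"
        by (intro continuous_intros continuous_on_subset[OF g_cont]) auto
    next
      fix t \<eta> :: real assume t: "0 \<le> t" "t < T" and \<eta>: "0 < \<eta>"
      let ?G = "\<lambda>z. F (z, \<theta> (t + h))"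
      let ?r = "F (x t, \<theta> (t + h)) - F (x t, \<theta> t)"
      have r: "NX ?r \<le> \<l> * (h * (?g t + \<epsilon>))"
      proof -
        have "NX ?r \<le> \<l> * N\<Theta> (\<theta> (t + h) - \<theta> t)"
          using t h by (intro A2 funcset_mem[OF x_in] funcset_mem[OF \<theta>_in]) auto
        also have "\<dots> \<le> \<l> * (h * (?g t + \<epsilon>))"
          using h_\<theta>[of t] t l_nonneg by (intro mult_left_mono) auto
        finally show ?thesis .
      qed
      have "((\<lambda>s. x (s + h)) has_vector_derivative F (x (t + h), \<theta> (t + h))) (at t within {0..})"
      proof -
        have "(x has_vector_derivative F (x (t + h), \<theta> (t + h))) (at (t + h) within (\<lambda>s. s + h) ` {0..})"
          by (rule has_vector_derivative_within_subset[OF x_solution]) (use t h in auto)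
        moreover have "((\<lambda>s. s + h) has_vector_derivative 1) (at t within {0..})"
          by (auto intro!: derivative_eq_intros)
        ultimately show ?thesis
          using vector_diff_chain_within[of "\<lambda>s. s + h" 1 t "{0..}" x] by (simp add: o_def)
      qed
      then have "(?y has_vector_derivative ?G (x (t + h)) - ?G (x t) + ?r) (at t within {0..})"
        using x_solution[OF t(1)] by (auto intro!: derivative_eq_intros)
      from osL_le_dini_norm[OF normX osL t(1) this refl \<eta>] t h
      have "\<forall>\<^sub>F k in at_right 0. NX (?y (t + k))
          \<le> NX (?y t) + k * (- c * NX (?y t) + NX ?r + \<eta>)" by simp
      moreover have "\<forall>\<^sub>F k in at_right (0::real). 0 < k"
        by (simp add: eventually_at_right_less)
      ultimately show "\<forall>\<^sub>F k in at_right 0. NX (?y (t + k))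
          \<le> NX (?y t) + k * (- c * NX (?y t) + \<l> * (h * (?g t + \<epsilon>)) + \<eta>)"
      proof eventually_elim
        case (elim k)
        have "k * NX ?r \<le> k * (\<l> * (h * (?g t + \<epsilon>)))"
          using r elim(2) by (intro mult_left_mono) auto
        then show ?case using elim(1) by (simp add: algebra_simps)
      qed
    qed
    also have "integral {0..T} (\<lambda>\<tau>. exp (- c * (T - \<tau>)) * (\<l> * (h * (?g \<tau> + \<epsilon>))))
        = h * (\<l> * ?I + \<l> * \<epsilon> * E)"
    proof -
      have int: "(\<lambda>\<tau>. exp (- c * (T - \<tau>)) * ?g \<tau>) integrable_on {0..T}"
        "(\<lambda>\<tau>. exp (- c * (T - \<tau>))) integrable_on {0..T}"
        by (intro integrable_continuous_interval continuous_intros continuous_on_subset[OF g_cont]; simp)+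
      have "((\<lambda>\<tau>. h * \<l> * (exp (- c * (T - \<tau>)) * ?g \<tau>) + h * \<l> * \<epsilon> * exp (- c * (T - \<tau>)))
          has_integral (h * \<l> * ?I + h * \<l> * \<epsilon> * E)) {0..T}"
        unfolding E_def by (intro has_integral_add has_integral_mult_right integrable_integral int)
      moreover have "(\<lambda>\<tau>. h * \<l> * (exp (- c * (T - \<tau>)) * ?g \<tau>) + h * \<l> * \<epsilon> * exp (- c * (T - \<tau>)))
          = (\<lambda>\<tau>. exp (- c * (T - \<tau>)) * (\<l> * (h * (?g \<tau> + \<epsilon>))))"
        by (simp add: fun_eq_iff algebra_simps)
      ultimately show ?thesis by (simp add: integral_unique distrib_left mult.assoc)
    qed
    finally have "NX (?y T) \<le> exp (- c * T) * NX (?y 0) + h * (\<l> * ?I + \<l> * \<epsilon> * E)" .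
    moreover have "h * NX (?f T) \<le> NX (?y T) + h * \<epsilon>"
      using NX_sub[of "h *\<^sub>R ?f T" "?y T"] is_norm_minus_commute[OF normX, of "h *\<^sub>R ?f T"] h h_T
      by (simp add: is_norm_scale[OF normX])
    moreover have "exp (- c * T) * NX (?y 0) \<le> exp (- c * T) * (h * NX (?f 0) + h * \<epsilon>)"
      using NX_sub[of "?y 0" "h *\<^sub>R ?f 0"] h h_0
      by (intro mult_left_mono) (simp_all add: is_norm_scale[OF normX])
    ultimately have "h * NX (?f T)
        \<le> exp (- c * T) * (h * NX (?f 0) + h * \<epsilon>) + h * (\<l> * ?I + \<l> * \<epsilon> * E) + h * \<epsilon>"
      by linarith
    also have "\<dots> = h * (exp (- c * T) * NX (?f 0) + \<l> * ?I + e)"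
      by (subst \<epsilon>(2)) (simp add: K_def algebra_simps)
    finally show "NX (?f T) \<le> exp (- c * T) * NX (?f 0) + \<l> * ?I + e"
      using h by simp
  qed

  have g_nonneg: "0 \<le> ?g t" for t by (rule is_norm_nonneg[OF norm\<Theta>])
  have "Limsup at_top (\<lambda>t. ereal (NX (x t - xs t)))
      \<le> ereal (\<l> / c / c) * Limsup at_top (\<lambda>t. ereal (?g t))"
    by (rule limsup_exponential_convolution[OF c_pos _ g_cont g_nonneg bound_i])
      (use l_nonneg c_pos in simp)
  moreover have "Limsup at_top (\<lambda>t. ereal (NX (?f t)))
      \<le> ereal (\<l> / c) * Limsup at_top (\<lambda>t. ereal (?g t))"
    by (rule limsup_exponential_convolution[OF c_pos l_nonneg g_cont g_nonneg bound_ii])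
  ultimately show ?thesis
    using bound_i bound_ii by (simp add: xs_def power2_eq_square)
qed

end
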